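(* For $c>Kc^\ast$, $K>1$, we have $$u^{[\mathcal{M}]}_{\alpha,t}(c)=\frac{D^2}{M^2}\,x_\alpha(c)\,\big(1+o(1)\big),\qquad t\to\infty,$$ where $x_\alpha(c)$ is a positive solution $x$ to the equation $$\left(1-\Phi\left(\frac{cM-2}{cM}\,x^{1/2}\right)\right)\exp\left\{-2\,\frac{cM-1}{c^2M^2}\,x\right\}+\Phi\left(x^{1/2}\right)=1+\alpha.$$
   Context: $M>0$ and $D>0$ are fixed constants (in the underlying renewal model with inter-renewal time $T$ and jump size $Y$, $M=\mathsf{E}T/\mathsf{E}Y$ and $D^2=((\mathsf{E}T)^2\,\mathsf{D}Y+(\mathsf{E}Y)^2\,\mathsf{D}T)/(\mathsf{E}Y)^3$, $\mathsf{D}$ denoting variance), $c^\ast=M^{-1}$, and $\alpha$ is fixed, positive and reasonably small (e.g. $\alpha=0.05$). For $u,t,c>0$, $$\mathcal{M}_{u,c}(t)=\int_0^{ct/u}\frac{1}{x+1}\,\varphi_{\left(cM(x+1),\,\frac{c^2D^2}{u}(x+1)\right)}(x)\,dx,$$ where $\varphi_{(a,b^2)}(x)$ is the density at $x$ of the normal distribution with mean $a$ and variance $b^2$. The heuristic fixed-probability level $u^{[\mathcal{M}]}_{\alpha,t}(c)$ is a positive solution, with respect to $u$, of the equation $\mathcal{M}_{u,c}(t)=\alpha$. $\Phi$ is the standard normal c.d.f. *)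

theory Defs
  imports "HOL-Probability.Probability" "HOL-Real_Asymp.Real_Asymp"
begin

definition cstar :: "real \<Rightarrow> real" where
  "cstar M = inverse M"

text \<open>Note that \<open>normal_density\<close> takes the standard deviation, not the variance,
  as its second argument.\<close>

definition heuristic_prob :: "real \<Rightarrow> real \<Rightarrow> real \<Rightarrow> real \<Rightarrow> real \<Rightarrow> real" where
  "heuristic_prob M D u c t =
     integral {0..c * t / u}
       (\<lambda>x. 1 / (x + 1) *
          normal_density (c * M * (x + 1)) (sqrt (c\<^sup>2 * D\<^sup>2 / u * (x + 1))) x)"

text \<open>\<open>is_level M D \<alpha> c t u\<close>: the number \<open>u\<close> is a possible value of the heuristic
  fixed-probability level. This is a relation and not a function, because for small \<open>\<alpha>\<close> the
  defining equation has more than one positive solution: its left-hand side vanishes both for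
  \<open>u\<close> tending to \<open>0\<close> and for \<open>u\<close> tending to infinity.
  In \<open>is_x\<close> below, likewise, the left-hand side tends to \<open>1\<close> at both ends.\<close>

definition is_level :: "real \<Rightarrow> real \<Rightarrow> real \<Rightarrow> real \<Rightarrow> real \<Rightarrow> real \<Rightarrow> bool" where
  "is_level M D \<alpha> c t u \<longleftrightarrow> u > 0 \<and> heuristic_prob M D u c t = \<alpha>"

definition Phi :: "real \<Rightarrow> real" where
  "Phi = cdf std_normal_distribution"

definition is_x :: "real \<Rightarrow> real \<Rightarrow> real \<Rightarrow> real \<Rightarrow> bool" where
  "is_x M \<alpha> c x \<longleftrightarrow> x > 0 \<and>
     (1 - Phi ((c * M - 2) / (c * M) * sqrt x)) * exp (- 2 * ((c * M - 1) / (c\<^sup>2 * M\<^sup>2)) * x)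
       + Phi (sqrt x) = 1 + \<alpha>"

definition is_greatest :: "(real \<Rightarrow> bool) \<Rightarrow> real \<Rightarrow> bool" where
  "is_greatest P x \<longleftrightarrow> P x \<and> (\<forall>y. P y \<longrightarrow> y \<le> x)"

end

theory Submission
  imports Defs
begin

text \<open>
  With \<open>s = x + 1\<close> the integrand is \<open>exp (- 2 * \<lambda> * (c * M - 1))\<close> times an inverse Gaussian density,
  where \<open>\<lambda> = u / (c\<^sup>2 * D\<^sup>2)\<close>, so the integral has a closed form in terms of \<open>Phi\<close>. In the variable
  \<open>y = sqrt u * M / D\<close> the integral over all \<open>x > 0\<close> does not depend on \<open>D\<close> and equals the left-hand side of
  the equation for \<open>x\<^sub>\<alpha>\<close> at \<open>x = y\<^sup>2\<close>, minus \<open>1\<close>. This limit function \<open>h\<close> vanishes at \<open>0\<close> and at infinity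
  and is unimodal, so for \<open>\<alpha>\<close> below its maximum \<open>\<alpha>0\<close> the equation \<open>h y = \<alpha>\<close> has exactly two solutions.
  The truncated integrals approach \<open>h\<close> strictly from below and uniformly on compact sets of positive \<open>y\<close>.
  Hence their \<open>\<alpha>\<close>-levels lie between the two solutions and accumulate only there, and near each of the
  two there is a level by the intermediate value theorem.
\<close>

subsection \<open>The standard normal distribution function\<close>

interpretation std_normal: real_distribution std_normal_distribution
  by (rule real_dist_normal_dist)

text \<open>The cdf increment is a Lebesgue integral over a half-open interval; adding the left
  endpoint, a null set, gives the gauge integral that the fundamental theorem of calculus
  differentiates.\<close>

lemma std_normal_density_has_integral:
  assumes "a < b"
  shows "(std_normal_density has_integral (Phi b - Phi a)) {a..b}"
proof -
  have "Phi b - Phi a = measure std_normal_distribution {a<..b}"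
    unfolding Phi_def using std_normal.cdf_diff_eq[OF assms] by simp
  also have "\<dots> = (LINT x|std_normal_distribution. indicator {a<..b} x)"
    by simp
  also have "\<dots> = (LINT x:{a<..b}|lborel. std_normal_density x)"
    unfolding set_lebesgue_integral_def
    by (subst integral_density) (auto simp: mult.commute)
  finally have eq: "Phi b - Phi a = \<dots>" .
  have int: "set_integrable lborel {a<..b} std_normal_density"
    unfolding set_integrable_def
    by (intro integrable_mult_indicator) auto
  have "(std_normal_density has_integral (Phi b - Phi a)) {a<..b}"
    unfolding eq set_borel_integral_eq_integral(2)[OF int]
    using set_borel_integral_eq_integral(1)[OF int] by (rule integrable_integral)
  moreover have "negligible {x \<in> {a<..b} - {a..b}. std_normal_density x \<noteq> 0}"
    by (rule empty_imp_negligible) auto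
  moreover have "negligible {x \<in> {a..b} - {a<..b}. std_normal_density x \<noteq> 0}"
    by (rule negligible_subset[of "{a}"]) auto
  ultimately show ?thesis
    using has_integral_spike_set_eq by blast
qed

lemma Phi_has_real_derivative [derivative_intros]:
  assumes "(f has_real_derivative f') (at x within S)"
  shows "((\<lambda>x. Phi (f x)) has_real_derivative std_normal_density (f x) * f') (at x within S)"
proof -
  have "(Phi has_real_derivative std_normal_density z) (at z)" for z
  proof -
    \<comment> \<open>Near \<open>z\<close>, \<open>Phi\<close> differs by a constant from an
      integral with the fixed lower limit \<open>z - 1\<close>.\<close>
    have int: "integral {z - 1..y} std_normal_density = Phi y - Phi (z - 1)" if "y \<in> {z - 1<..<z + 1}" for y
      using std_normal_density_has_integral[of "z - 1" y] that by auto
    have "((\<lambda>y. integral {z - 1..y} std_normal_density) has_real_derivative std_normal_density z)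
        (at z within {z - 1..z + 1})"
      unfolding has_real_derivative_iff_has_vector_derivative
      by (rule integral_has_vector_derivative)
         (auto simp: normal_density_def intro!: continuous_intros)
    then have "((\<lambda>y. integral {z - 1..y} std_normal_density) has_real_derivative std_normal_density z) (at z)"
      by (subst (asm) at_within_interior) auto
    then have "((\<lambda>y. Phi y - Phi (z - 1)) has_real_derivative std_normal_density z) (at z)"
      by (rule has_field_derivative_transform_within_open[of _ _ _ "{z - 1<..<z + 1}"])
         (use int in auto)
    from DERIV_add[OF this DERIV_const[of "Phi (z - 1)"]] show ?thesis
      by simp
  qed
  from DERIV_chain2[OF this assms] show ?thesis .
qed

lemma continuous_on_Phi [continuous_intros]:
  assumes "continuous_on S f"
  shows "continuous_on S (\<lambda>x. Phi (f x))"
proof -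
  have "continuous_on UNIV Phi"
    by (rule continuous_at_imp_continuous_on) (auto intro!: DERIV_isCont Phi_has_real_derivative[OF DERIV_ident])
  from continuous_on_compose2[OF this assms] show ?thesis by simp
qed

lemma Phi_at_top: "(Phi \<longlongrightarrow> 1) at_top"
  and Phi_mono: "x \<le> y \<Longrightarrow> Phi x \<le> Phi y"
  and Phi_le_1: "Phi x \<le> 1"
  and Phi_nonneg: "0 \<le> Phi x"
  unfolding Phi_def
  by (rule std_normal.cdf_lim_at_top_prob std_normal.cdf_nondecreasing
      std_normal.cdf_bounded_prob std_normal.cdf_nonneg | assumption)+

subsection \<open>Levels of functions converging to a unimodal limit\<close>

text \<open>\<open>h\<close> stands for the integral over all \<open>x > 0\<close> and
  \<open>P t\<close> for the truncated one, both as functions of \<open>y\<close>. The upper bound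
  on \<open>P t\<close> is strict for every positive \<open>t\<close>, the lower bound is uniform on
  compact sets; the rest about levels follows from continuity and order alone.\<close>

locale unimodal_limit =
  fixes h :: "real \<Rightarrow> real" and P :: "real \<Rightarrow> real \<Rightarrow> real" and m :: real
  assumes m_pos: "0 < m"
    and cont_h: "continuous_on {0..} h"
    and h_0: "h 0 = 0"
    and h_at_top: "(h \<longlongrightarrow> 0) at_top"
    and h_increasing: "0 \<le> x \<Longrightarrow> x < y \<Longrightarrow> y \<le> m \<Longrightarrow> h x < h y"
    and h_decreasing: "m \<le> x \<Longrightarrow> x < y \<Longrightarrow> h y < h x"
    and cont_P: "0 < t \<Longrightarrow> continuous_on {0<..} (P t)"
    and P_less: "0 < t \<Longrightarrow> 0 < y \<Longrightarrow> P t y < h y"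
    and P_uniform: "0 < l \<Longrightarrow> 0 < e \<Longrightarrow> \<forall>\<^sub>F t in at_top. \<forall>y\<in>{l..r}. h y - e < P t y"
begin

lemma h_le_max: "0 \<le> y \<Longrightarrow> h y \<le> h m"
  using h_increasing[of y m] h_decreasing[of m y] by (cases y m rule: linorder_cases) auto

lemma max_pos: "0 < h m"
  using h_increasing[of 0 m] m_pos h_0 by simp

text \<open>Strictness in \<open>P_less\<close> excludes the borderline case \<alpha> =
  \<open>h m\<close> too, which makes \<open>h m\<close> an exact threshold.\<close>

lemma no_root:
  assumes "h m \<le> \<alpha>" "0 < t" "0 < y"
  shows "P t y \<noteq> \<alpha>"
  using P_less[OF assms(2,3)] h_le_max[of y] assms by auto

lemma P_gt_eventually:
  assumes "0 < y" "\<alpha> < h y"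
  shows "\<forall>\<^sub>F t in at_top. \<alpha> < P t y"
  using P_uniform[of y "h y - \<alpha>" y] assms by simp

end

section \<open>The two solutions of \<open>h y = \<alpha>\<close> and the levels near them\<close>

locale unimodal_limit_level = unimodal_limit +
  fixes \<alpha> :: real
  assumes \<alpha>_pos: "0 < \<alpha>" and \<alpha>_less: "\<alpha> < h m"
begin

lemma ex_y1: "\<exists>y. 0 < y \<and> y < m \<and> h y = \<alpha>"
proof -
  have "continuous_on {0..m} h"
    by (rule continuous_on_subset[OF cont_h]) auto
  then obtain y where "0 \<le> y" "y \<le> m" "h y = \<alpha>"
    using IVT'[of h 0 \<alpha> m] h_0 \<alpha>_pos \<alpha>_less m_pos by auto
  moreover from this have "y \<noteq> 0" "y \<noteq> m"
    using h_0 \<alpha>_pos \<alpha>_less by auto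
  ultimately show ?thesis by (intro exI[of _ y]) auto
qed

lemma ex_y2: "\<exists>y>m. h y = \<alpha>"
proof -
  have "\<forall>\<^sub>F y in at_top. h y < \<alpha> \<and> m \<le> y"
    using order_tendstoD(2)[OF h_at_top \<alpha>_pos] eventually_ge_at_top by (rule eventually_conj)
  then obtain r where r: "h r < \<alpha>" "m \<le> r"
    by (auto dest: eventually_happens)
  have "continuous_on {m..r} h"
    by (rule continuous_on_subset[OF cont_h]) (use m_pos in auto)
  then obtain y where "m \<le> y" "h y = \<alpha>"
    using IVT2'[of h r \<alpha> m] r \<alpha>_less by auto
  moreover from this have "y \<noteq> m"
    using \<alpha>_less by auto
  ultimately show ?thesis by (intro exI[of _ y]) auto
qed

definition "y1 = (SOME y. 0 < y \<and> y < m \<and> h y = \<alpha>)"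
definition "y2 = (SOME y. m < y \<and> h y = \<alpha>)"

lemma y1: "0 < y1" "y1 < m" "h y1 = \<alpha>"
  using someI_ex[OF ex_y1] by (auto simp: y1_def)

lemma y2: "m < y2" "h y2 = \<alpha>"
  using someI_ex[OF ex_y2] by (auto simp: y2_def)

lemma less_h_iff:
  assumes "0 < y" shows "\<alpha> < h y \<longleftrightarrow> y1 < y \<and> y < y2"
  using h_increasing[of y y1] h_increasing[of y1 y] h_decreasing[of y y2] h_decreasing[of y2 y] y1 y2 assms
  by (cases y y1 rule: linorder_cases; cases y y2 rule: linorder_cases; cases "y \<le> m") auto

lemma h_eq_iff:
  assumes "0 < y" shows "h y = \<alpha> \<longleftrightarrow> y = y1 \<or> y = y2"
  using h_increasing[of y y1] h_increasing[of y1 y] h_decreasing[of y y2] h_decreasing[of y2 y] y1 y2 assms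
  by (cases y y1 rule: linorder_cases; cases y y2 rule: linorder_cases; cases "y \<le> m") auto

lemma root_between:
  assumes "0 < t" "0 < y" "P t y = \<alpha>"
  shows "y1 < y" "y < y2"
  using P_less[OF assms(1,2)] less_h_iff[OF assms(2)] assms(3) by auto

text \<open>The solution is selected by the side of \<open>m\<close> instead of by distance:
  \<open>P t m\<close> eventually exceeds \<alpha>, so \<open>m\<close> separates the two families
  of roots.\<close>

definition nearest :: "real \<Rightarrow> real" where
  "nearest y = (if y < m then y1 else y2)"

text \<open>Between its two solutions and away from them, \<open>h\<close> exceeds \<alpha> by a
  fixed margin; uniform convergence passes this on to \<open>P t\<close>, so a root can only sit
  close to \<open>y1\<close> or \<open>y2\<close>.\<close>

lemma roots_near:
  assumes "0 < e"
  shows "\<forall>\<^sub>F t in at_top. \<forall>y>0. P t y = \<alpha> \<longrightarrow> \<bar>y - nearest y\<bar> < e"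
proof -
  \<comment> \<open>At most half of each gap, so \<open>y1 + d\<close> and \<open>y2 - d\<close>
    stay on their own sides of \<open>m\<close>. By unimodality \<open>h\<close> is then smallest
    over the interval at one of its ends, which gives the margin \<open>\<delta>\<close>.\<close>
  define d where "d = min e (min (m - y1) (y2 - m)) / 2"
  have d: "0 < d" "d < e" "y1 + d < m" "m < y2 - d"
    using assms y1 y2 by (auto simp: d_def min_def field_simps)
  define \<delta> where "\<delta> = min (h (y1 + d)) (h (y2 - d)) - \<alpha>"
  have "\<delta> > 0"
    using less_h_iff[of "y1 + d"] less_h_iff[of "y2 - d"] y1 y2 d by (auto simp: \<delta>_def)
  then have "\<forall>\<^sub>F t in at_top. \<forall>y\<in>{y1 + d..y2 - d}. h y - \<delta> < P t y"
    using P_uniform[of "y1 + d" \<delta>] y1 d by auto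
  then show ?thesis
    using eventually_gt_at_top[of 0]
  proof eventually_elim
    case (elim t)
    show ?case
    proof (intro allI impI)
      fix y :: real assume y: "0 < y" "P t y = \<alpha>"
      note b = root_between[OF \<open>0 < t\<close> y]
      have "y \<notin> {y1 + d..y2 - d}"
      proof
        assume A: "y \<in> {y1 + d..y2 - d}"
        have "min (h (y1 + d)) (h (y2 - d)) \<le> h y"
          using h_increasing[of "y1 + d" y] h_decreasing[of y "y2 - d"] A y1 d
          by (cases "y \<le> m"; cases "y = y1 + d"; cases "y = y2 - d") auto
        then show False
          using elim(1) A y(2) by (force simp: \<delta>_def)
      qed
      then show "\<bar>y - nearest y\<bar> < e"
        using b d by (auto simp: nearest_def)
    qed
  qed
qed

lemma root_tendsto_nearest:
  assumes "\<forall>\<^sub>F t in at_top. 0 < y t \<and> P t (y t) = \<alpha>"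
  shows "((\<lambda>t. y t - nearest (y t)) \<longlongrightarrow> 0) at_top"
proof (rule tendstoI)
  fix e :: real assume "0 < e"
  from roots_near[OF this] assms show "\<forall>\<^sub>F t in at_top. dist (y t - nearest (y t)) 0 < e"
    by eventually_elim auto
qed

lemma P_max_gt: "\<forall>\<^sub>F t in at_top. 0 < t \<and> \<alpha> < P t m"
  using P_gt_eventually[OF m_pos \<alpha>_less] eventually_gt_at_top[of 0]
  by eventually_elim auto

lemma nearest_ge: "y1 \<le> nearest y"
  using y1 y2 by (simp add: nearest_def)

lemma h_nearest: "h (nearest y) = \<alpha>"
  using y1 y2 by (simp add: nearest_def)

text \<open>\<open>nearest\<close> is bounded below by \<open>y1 > 0\<close>, so a vanishing
  absolute error is a vanishing relative error.\<close>

lemma root_asymp_equiv_nearest: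
  assumes "\<forall>\<^sub>F t in at_top. 0 < y t \<and> P t (y t) = \<alpha>"
  shows "y \<sim>[at_top] (\<lambda>t. nearest (y t))"
proof (rule asymp_equivI')
  have "((\<lambda>t. (y t - nearest (y t)) / nearest (y t)) \<longlongrightarrow> 0) at_top"
  proof (rule Lim_null_comparison)
    show "((\<lambda>t. \<bar>y t - nearest (y t)\<bar> / y1) \<longlongrightarrow> 0) at_top"
      using root_tendsto_nearest[OF assms]
      by (intro tendsto_divide_zero tendsto_rabs_zero)
    show "\<forall>\<^sub>F t in at_top. norm ((y t - nearest (y t)) / nearest (y t)) \<le> \<bar>y t - nearest (y t)\<bar> / y1"
    proof (intro always_eventually allI)
      fix t
      show "norm ((y t - nearest (y t)) / nearest (y t)) \<le> \<bar>y t - nearest (y t)\<bar> / y1"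
        using nearest_ge[of "y t"] y1(1) by (auto simp: abs_divide intro!: divide_left_mono mult_pos_pos)
    qed
  qed
  from tendsto_add[OF this tendsto_const[of 1]]
  have "((\<lambda>t. (y t - nearest (y t)) / nearest (y t) + 1) \<longlongrightarrow> 1) at_top"
    by simp
  moreover have "(y t - nearest (y t)) / nearest (y t) + 1 = y t / nearest (y t)" for t
    using nearest_ge[of "y t"] y1(1) by (simp add: field_simps)
  ultimately show "((\<lambda>t. y t / nearest (y t)) \<longlongrightarrow> 1) at_top"
    by simp
qed

text \<open>Eventually \<open>P t m\<close> exceeds \<alpha>, so no root equals \<open>m\<close>; by
  the intermediate value theorem a continuous one cannot change sides.\<close>

lemma continuous_root_nearest_constant:
  assumes "\<forall>\<^sub>F t in at_top. 0 < y t \<and> P t (y t) = \<alpha>" and cont: "continuous_on {t0..} y"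
  obtains T where "\<forall>\<^sub>F t in at_top. nearest (y t) = nearest (y T)"
proof -
  have "\<forall>\<^sub>F t in at_top. y t \<noteq> m"
    using assms(1) P_max_gt by eventually_elim auto
  then obtain T1 where T1: "\<And>t. T1 \<le> t \<Longrightarrow> y t \<noteq> m"
    by (auto simp: eventually_at_top_linorder)
  define T where "T = max T1 t0"
  have "nearest (y t) = nearest (y T)" if "T \<le> t" for t
  proof -
    have c: "continuous_on {T..t} y"
      by (rule continuous_on_subset[OF cont]) (auto simp: T_def)
    have "\<not> (y T \<le> m \<and> m \<le> y t)" "\<not> (y t \<le> m \<and> m \<le> y T)"
      using IVT'[OF _ _ that c, of m] IVT2'[OF _ _ that c, of m] T1 by (force simp: T_def)+
    then have "y t < m \<longleftrightarrow> y T < m" by linarith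
    then show ?thesis by (simp add: nearest_def)
  qed
  then have "\<forall>\<^sub>F t in at_top. nearest (y t) = nearest (y T)"
    by (rule eventually_mono[OF eventually_ge_at_top])
  then show thesis by (rule that)
qed

text \<open>The crossing lies between \<open>y1\<close>, where \<open>P t\<close> is below
  \<open>h y1 = \<alpha>\<close>, and \<open>m\<close>, where it is eventually above.\<close>

lemma ex_lower_root: "\<forall>\<^sub>F t in at_top. \<exists>y. 0 < y \<and> y < m \<and> P t y = \<alpha>"
  using P_max_gt
proof eventually_elim
  case (elim t)
  have "continuous_on {y1..m} (P t)"
    by (rule continuous_on_subset[OF cont_P]) (use elim y1 in auto)
  then obtain y where "y1 \<le> y" "y \<le> m" "P t y = \<alpha>"
    using IVT'[of "P t" y1 \<alpha> m] P_less[of t y1] elim y1 by auto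
  then show ?case using elim y1 by (intro exI[of _ y]) (auto simp: less_le)
qed

text \<open>\<open>P t\<close> may cross the level several times beyond \<open>m\<close>, so
  compactness is used: the roots in \<open>{m..y2}\<close> form a nonempty compact set, and no root
  exceeds \<open>y2\<close>.\<close>

lemma ex_greatest_root:
  "\<forall>\<^sub>F t in at_top. \<exists>y>m. P t y = \<alpha> \<and> (\<forall>z>0. P t z = \<alpha> \<longrightarrow> z \<le> y)"
  using P_max_gt
proof eventually_elim
  case (elim t)
  define A where "A = {m..y2} \<inter> P t -` {\<alpha>}"
  have cont: "continuous_on {m..y2} (P t)"
    by (rule continuous_on_subset[OF cont_P]) (use elim m_pos in auto)
  have "A \<noteq> {}"
    using IVT2'[of "P t" y2 \<alpha> m] P_less[of t y2] elim y2 m_pos cont by (auto simp: A_def)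
  moreover have "compact A"
    unfolding compact_eq_bounded_closed A_def
    using continuous_closed_preimage[OF cont] bounded_subset[of "{m..y2}"] by auto
  ultimately obtain y where y: "y \<in> A" "\<And>z. z \<in> A \<Longrightarrow> z \<le> y"
    using compact_attains_sup[of A] by metis
  have "z \<le> y" if "0 < z" "P t z = \<alpha>" for z
    using y(2)[of z] y(1) that root_between[of t z] elim by (cases "m \<le> z") (auto simp: A_def)
  then show ?case using y(1) elim by (intro exI[of _ y]) (auto simp: A_def less_le)
qed

end

subsection \<open>The closed form of the integral\<close>

text \<open>For \<open>b = c * M\<close> and \<open>y = sqrt u * M / D\<close>, this is the integral of the integrand of
  \<open>heuristic_prob\<close> over \<open>x \<ge> s - 1\<close>.\<close>

definition tail :: "real \<Rightarrow> real \<Rightarrow> real \<Rightarrow> real" where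
  "tail b y s = exp (- 2 * ((b - 1) / b\<^sup>2) * y\<^sup>2) * (1 - Phi (y / b * (((b - 1) * s - 1) / sqrt s)))
     - (1 - Phi (y / b * (((b - 1) * s + 1) / sqrt s)))"

text \<open>The squares of \<open>(b - 1) * s + 1\<close> and \<open>(b - 1) * s - 1\<close> differ
  by \<open>4 * (b - 1) * s\<close>; division by \<open>s\<close> leaves an exponent free of
  \<open>s\<close>, so the prefactor in \<open>tail\<close> can be constant.\<close>

lemma exp_mult_std_normal_density:
  assumes "0 < s"
  shows "exp (- 2 * ((b - 1) / b\<^sup>2) * y\<^sup>2) * std_normal_density (y / b * (((b - 1) * s - 1) / sqrt s))
    = std_normal_density (y / b * (((b - 1) * s + 1) / sqrt s))"
proof -
  have "- 2 * ((b - 1) / b\<^sup>2) * y\<^sup>2 + - (y / b * (((b - 1) * s - 1) / sqrt s))\<^sup>2 / 2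
      = - (y / b * (((b - 1) * s + 1) / sqrt s))\<^sup>2 / 2"
    using assms by (cases "b = 0") (simp_all add: field_simps power2_eq_square)
  then show ?thesis
    by (simp add: std_normal_density_def exp_add[symmetric])
qed

text \<open>By the previous identity both \<open>Phi\<close> terms contribute the same density
  \<open>p\<close>; the parts with \<open>(b - 1) * s\<close> cancel, and for \<open>1 < b\<close> a
  multiple of an inverse Gaussian density remains.\<close>

lemma tail_has_real_derivative:
  assumes "0 < s" "b \<noteq> 0"
  shows "(tail b y has_real_derivative
    - (y / b / (s * sqrt s) * std_normal_density (y / b * (((b - 1) * s + 1) / sqrt s)))) (at s)"
proof -
  define E where "E = exp (- 2 * ((b - 1) / b\<^sup>2) * y\<^sup>2)"
  define p where "p = std_normal_density (y / b * (((b - 1) * s + 1) / sqrt s))"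
  define q where "q = std_normal_density (y / b * (((b - 1) * s - 1) / sqrt s))"
  have Eq: "E * q = p"
    unfolding E_def q_def p_def by (rule exp_mult_std_normal_density[OF assms(1)])
  define r where "r = sqrt s"
  have r: "r > 0" "s = r * r" using assms by (auto simp: r_def)
  have z: "((\<lambda>s. y / b * (((b - 1) * s + e) / sqrt s)) has_real_derivative
        y / b * ((b - 1) * s - e) / (2 * s * sqrt s)) (at s)" for e
    using assms r
    by (auto intro!: derivative_eq_intros simp flip: r_def simp: field_simps power2_eq_square r(2))
  have P: "((\<lambda>s. Phi (y / b * (((b - 1) * s + e) / sqrt s))) has_real_derivative
      std_normal_density (y / b * (((b - 1) * s + e) / sqrt s)) * (y / b * ((b - 1) * s - e) / (2 * s * sqrt s)))
      (at s)" for e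
    by (rule Phi_has_real_derivative[OF z])
  have "((\<lambda>s. E * (1 - Phi (y / b * (((b - 1) * s + - 1) / sqrt s)))
      - (1 - Phi (y / b * (((b - 1) * s + 1) / sqrt s)))) has_real_derivative
      E * (0 - std_normal_density (y / b * (((b - 1) * s + - 1) / sqrt s)) * (y / b * ((b - 1) * s - - 1) / (2 * s * sqrt s)))
      - (0 - p * (y / b * ((b - 1) * s - 1) / (2 * s * sqrt s)))) (at s)"
    unfolding p_def by (intro DERIV_diff DERIV_cmult DERIV_const P)
  then have "(tail b y has_real_derivative
      - (E * (q * (y / b * ((b - 1) * s - - 1) / (2 * s * sqrt s))))
      + p * (y / b * ((b - 1) * s - 1) / (2 * s * sqrt s))) (at s)"
    by (simp add: tail_def[abs_def] E_def q_def)
  also have "E * (q * (y / b * ((b - 1) * s - - 1) / (2 * s * sqrt s)))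
      = p * (y / b * ((b - 1) * s - - 1) / (2 * s * sqrt s))"
    unfolding Eq[symmetric] by simp
  also have "- (p * (y / b * ((b - 1) * s - - 1) / (2 * s * sqrt s)))
      + p * (y / b * ((b - 1) * s - 1) / (2 * s * sqrt s)) = - (y / b / (s * sqrt s) * p)"
    using assms r(1) unfolding r_def[symmetric] r(2)
    by (simp add: field_simps)
  finally show ?thesis unfolding p_def .
qed

lemma tail_le:
  assumes "1 < b"
  shows "tail b y s \<le> 1 - Phi (y / b * (((b - 1) * s - 1) / sqrt s))"
proof -
  have "exp (- 2 * ((b - 1) / b\<^sup>2) * y\<^sup>2) \<le> 1"
    using assms by (simp add: mult_nonneg_nonneg divide_nonpos_nonneg mult_nonpos_nonneg)
  then have "exp (- 2 * ((b - 1) / b\<^sup>2) * y\<^sup>2) * (1 - Phi (y / b * (((b - 1) * s - 1) / sqrt s)))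
      \<le> 1 * (1 - Phi (y / b * (((b - 1) * s - 1) / sqrt s)))"
    by (intro mult_right_mono) (auto simp: Phi_le_1)
  then show ?thesis
    using Phi_le_1[of "y / b * (((b - 1) * s + 1) / sqrt s)"] by (simp add: tail_def)
qed

lemma tail_tendsto_0:
  assumes "1 < b" "0 < y"
  shows "(tail b y \<longlongrightarrow> 0) at_top"
proof -
  define w where "w = y / b"
  define a where "a = b - 1"
  have pos: "0 < w" "0 < a" using assms by (auto simp: w_def a_def)
  \<comment> \<open>Both arguments grow like \<open>sqrt s\<close> because \<open>b - 1\<close> is
    positive.\<close>
  have "filterlim (\<lambda>s. w * ((a * s - 1) / sqrt s)) at_top at_top"
    "filterlim (\<lambda>s. w * ((a * s + 1) / sqrt s)) at_top at_top"
    using pos by real_asymp+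
  note lim = this[THEN filterlim_compose[OF Phi_at_top]]
  have "(tail b y \<longlongrightarrow> exp (- 2 * ((b - 1) / b\<^sup>2) * y\<^sup>2) * (1 - 1) - (1 - 1)) at_top"
    unfolding tail_def using lim unfolding w_def a_def by (intro tendsto_intros)
  then show ?thesis by simp
qed

text \<open>\<open>tail b y\<close> decreases strictly to 0. This puts the truncated integrals
  strictly below the limit function.\<close>

lemma tail_pos:
  assumes "1 < b" "0 < y" "0 < s"
  shows "0 < tail b y s"
proof (rule DERIV_neg_imp_decreasing_at_top[OF _ tail_tendsto_0])
  fix x :: real assume "s \<le> x"
  then show "\<exists>d. (tail b y has_real_derivative d) (at x) \<and> d < 0"
    using tail_has_real_derivative[of x b y] assms
    by (intro exI[of _ "- (y / b / (x * sqrt x) * std_normal_density (y / b * (((b - 1) * x + 1) / sqrt x)))"])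
       (auto intro!: mult_pos_pos divide_pos_pos normal_density_pos)
qed (use assms in auto)

section \<open>Unimodality of the limit function \<open>tail b y 1\<close>\<close>

lemma tail_1:
  "b \<noteq> 0 \<Longrightarrow> tail b y 1 = exp (- 2 * ((b - 1) / b\<^sup>2) * y\<^sup>2) * (1 - Phi ((b - 2) / b * y)) - (1 - Phi y)"
  by (simp add: tail_def algebra_simps diff_divide_distrib)

lemma tail_1_at_top:
  assumes "1 < b"
  shows "((\<lambda>y. tail b y 1) \<longlongrightarrow> 0) at_top"
proof (rule tendsto_sandwich)
  define k where "k = 2 * ((b - 1) / b\<^sup>2)"
  have "k > 0" using assms by (simp add: k_def)
  show "\<forall>\<^sub>F y in at_top. 0 \<le> tail b y 1"
    using eventually_gt_at_top[of 0] by eventually_elim (simp add: tail_pos[OF assms] less_imp_le)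
  have "exp (- k * y\<^sup>2) * (1 - Phi ((b - 2) / b * y)) \<le> exp (- k * y\<^sup>2) * 1" for y
    by (intro mult_left_mono) (auto simp: Phi_nonneg)
  moreover have "tail b y 1 = exp (- k * y\<^sup>2) * (1 - Phi ((b - 2) / b * y)) - (1 - Phi y)" for y
    using assms by (subst tail_1) (simp_all only: k_def minus_mult_left)
  ultimately have "tail b y 1 \<le> exp (- k * y\<^sup>2)" for y
    using Phi_le_1[of y] by (smt (verit) mult_cancel_left1)
  then show "\<forall>\<^sub>F y in at_top. tail b y 1 \<le> exp (- k * y\<^sup>2)"
    by simp
  show "((\<lambda>y. exp (- k * y\<^sup>2)) \<longlongrightarrow> 0) at_top"
    using \<open>k > 0\<close> by real_asymp
qed auto

text \<open>The derivative of \<open>\<lambda>y. tail b y 1\<close> divided by a positive factor that makes the remaining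
  \<open>1 - Phi\<close> term free of non-constant factors, so that differentiating once more eliminates \<open>Phi\<close>.\<close>

definition slope_sign :: "real \<Rightarrow> real \<Rightarrow> real" where
  "slope_sign b y = b / (2 * (b - 1)) * std_normal_density ((b - 2) / b * y) / y - (1 - Phi ((b - 2) / b * y))"

lemma tail_1_has_real_derivative:
  assumes "1 < b" "0 < y"
  shows "((\<lambda>y. tail b y 1) has_real_derivative
    4 * ((b - 1) / b\<^sup>2) * y * exp (- 2 * ((b - 1) / b\<^sup>2) * y\<^sup>2) * slope_sign b y) (at y)"
proof -
  define E where "E = exp (- 2 * ((b - 1) / b\<^sup>2) * y\<^sup>2)"
  define q where "q = std_normal_density ((b - 2) / b * y)"
  define Q where "Q = Phi ((b - 2) / b * y)"
  have "y / b * (((b - 1) * 1 - 1) / sqrt 1) = (b - 2) / b * y" "y / b * (((b - 1) * 1 + 1) / sqrt 1) = y"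
    using assms by (simp_all add: field_simps)
  \<comment> \<open>The density identity at \<open>s = 1\<close> gives every term the factor
    \<open>E\<close>; the density terms then add up to \<open>2 / b * q * E\<close>.\<close>
  then have Eq: "std_normal_density y = E * q"
    unfolding E_def q_def using exp_mult_std_normal_density[OF zero_less_one, of b y] by metis
  have "((\<lambda>y. exp (- 2 * k * y\<^sup>2)) has_real_derivative - 4 * k * y * exp (- 2 * k * y\<^sup>2)) (at y)" for k
    by (auto intro!: derivative_eq_intros)
  note D = this[of "(b - 1) / b\<^sup>2"] Phi_has_real_derivative[OF DERIV_cmult_Id] Phi_has_real_derivative[OF DERIV_ident]
  have "((\<lambda>y. tail b y 1) has_real_derivative
      - 4 * ((b - 1) / b\<^sup>2) * y * E * (1 - Q) + (0 - q * ((b - 2) / b)) * E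
      - (0 - std_normal_density y * 1)) (at y)"
    unfolding E_def q_def Q_def using assms
    by (subst tail_1) (intro DERIV_diff DERIV_mult DERIV_const D | simp)+
  also have "- 4 * ((b - 1) / b\<^sup>2) * y * E * (1 - Q) + (0 - q * ((b - 2) / b)) * E
      - (0 - std_normal_density y * 1)
     = 4 * ((b - 1) / b\<^sup>2) * y * E * (b / (2 * (b - 1)) * q / y - (1 - Q))"
    unfolding Eq using assms by (simp add: field_simps power2_eq_square)
  finally show ?thesis by (simp add: E_def q_def Q_def slope_sign_def)
qed

lemma slope_sign_has_real_derivative:
  assumes "1 < b" "0 < y"
  shows "(slope_sign b has_real_derivative
    std_normal_density ((b - 2) / b * y) * ((b - 2) - b / y\<^sup>2) / (2 * (b - 1))) (at y)"
proof -
  have d: "(std_normal_density has_real_derivative - z * std_normal_density z) (at z)" for z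
    unfolding std_normal_density_def
    by (auto intro!: derivative_eq_intros simp: field_simps)
  define q where "q = std_normal_density ((b - 2) / b * y)"
  have "((\<lambda>y. (b - 2) / b * y) has_real_derivative (b - 2) / b) (at y)"
    by (rule DERIV_cmult_Id)
  note D = DERIV_chain2[OF d this] Phi_has_real_derivative[OF this]
  have "(slope_sign b has_real_derivative
      (b / (2 * (b - 1)) * (- ((b - 2) / b * y) * q * ((b - 2) / b)) * y
        - b / (2 * (b - 1)) * q * 1) / (y * y)
      - (0 - q * ((b - 2) / b))) (at y)"
    unfolding slope_sign_def[abs_def] q_def
    by (intro DERIV_diff DERIV_divide DERIV_cmult DERIV_const DERIV_ident D) (use assms in auto)
  also have "(b / (2 * (b - 1)) * (- ((b - 2) / b * y) * q * ((b - 2) / b)) * y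
        - b / (2 * (b - 1)) * q * 1) / (y * y)
      - (0 - q * ((b - 2) / b))
      = q * ((b - 2) - b / y\<^sup>2) / (2 * (b - 1))"
    using assms by (simp add: divide_simps power2_eq_square) (simp add: algebra_simps)
  finally show ?thesis unfolding q_def .
qed

lemma continuous_on_tail:
  assumes "b \<noteq> 0" "continuous_on S f" "continuous_on S g" "\<And>x. x \<in> S \<Longrightarrow> 0 < g x"
  shows "continuous_on S (\<lambda>x. tail b (f x) (g x))"
  unfolding tail_def using assms
  by (intro continuous_intros ballI) (auto dest: assms(4))

lemma continuous_on_tail_1: "b \<noteq> 0 \<Longrightarrow> continuous_on S (\<lambda>y. tail b y 1)"
  by (rule continuous_on_tail) (auto intro: continuous_intros)

lemma tail_1_increasing:
  assumes "1 < b" "0 \<le> p" "p < q" and "\<And>y. p < y \<Longrightarrow> y < q \<Longrightarrow> 0 < slope_sign b y"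
  shows "tail b p 1 < tail b q 1"
proof (rule DERIV_pos_imp_increasing_open[OF assms(3)])
  show "\<exists>d. ((\<lambda>y. tail b y 1) has_real_derivative d) (at y) \<and> 0 < d" if "p < y" "y < q" for y
  proof (intro exI conjI)
    show "((\<lambda>y. tail b y 1) has_real_derivative
        4 * ((b - 1) / b\<^sup>2) * y * exp (- 2 * ((b - 1) / b\<^sup>2) * y\<^sup>2) * slope_sign b y) (at y)"
      using assms that by (intro tail_1_has_real_derivative) auto
    show "0 < 4 * ((b - 1) / b\<^sup>2) * y * exp (- 2 * ((b - 1) / b\<^sup>2) * y\<^sup>2) * slope_sign b y"
      using assms that by (intro mult_pos_pos mult_pos_pos divide_pos_pos) auto
  qed
qed (use assms continuous_on_tail_1 in auto)

lemma tail_1_decreasing: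
  assumes "1 < b" "0 \<le> p" "p < q" and "\<And>y. p < y \<Longrightarrow> y < q \<Longrightarrow> slope_sign b y < 0"
  shows "tail b q 1 < tail b p 1"
proof (rule DERIV_neg_imp_decreasing_open[OF assms(3)])
  show "\<exists>d. ((\<lambda>y. tail b y 1) has_real_derivative d) (at y) \<and> d < 0" if "p < y" "y < q" for y
  proof (intro exI conjI)
    show "((\<lambda>y. tail b y 1) has_real_derivative
        4 * ((b - 1) / b\<^sup>2) * y * exp (- 2 * ((b - 1) / b\<^sup>2) * y\<^sup>2) * slope_sign b y) (at y)"
      using assms that by (intro tail_1_has_real_derivative) auto
    show "4 * ((b - 1) / b\<^sup>2) * y * exp (- 2 * ((b - 1) / b\<^sup>2) * y\<^sup>2) * slope_sign b y < 0"
      using assms that by (intro mult_pos_neg mult_pos_pos divide_pos_pos) auto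
  qed
qed (use assms continuous_on_tail_1 in auto)

lemma tail_1_0: "b \<noteq> 0 \<Longrightarrow> tail b 0 1 = 0"
  by (simp add: tail_1)

text \<open>Otherwise \<open>tail b y 1\<close> would increase towards its limit 0 beyond
  \<open>p\<close>, against its positivity.\<close>

lemma slope_sign_not_eventually_pos:
  assumes "1 < b" "0 \<le> p"
  shows "\<exists>y>p. slope_sign b y \<le> 0"
proof (rule ccontr)
  assume "\<not> ?thesis"
  then have pos: "0 < slope_sign b y" if "p < y" for y
    using that by force
  have "tail b (p + 1) 1 \<le> 0"
  proof (rule tendsto_lowerbound[OF tail_1_at_top[OF assms(1)]])
    show "\<forall>\<^sub>F y in at_top. tail b (p + 1) 1 \<le> tail b y 1"
      using eventually_gt_at_top[of "p + 1"]
      by eventually_elim (use assms in \<open>auto intro!: less_imp_le tail_1_increasing pos\<close>)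
  qed auto
  with tail_pos[of b "p + 1" 1] assms show False by simp
qed

text \<open>If \<open>slope_sign b\<close> returned to a nonnegative value after \<open>p\<close>, its derivative would be nonnegative
  somewhere in between and, as \<open>b - 2 - b / y\<^sup>2\<close> is increasing, positive from there on; then \<open>tail b y 1\<close>
  would be eventually increasing, although it is positive and tends to \<open>0\<close>.\<close>

lemma slope_sign_neg_after:
  assumes b: "1 < b" and "0 < p" "slope_sign b p \<le> 0" "p < q"
  shows "slope_sign b q < 0"
proof (rule ccontr)
  assume q: "\<not> ?thesis"
  define dg where "dg y = std_normal_density ((b - 2) / b * y) * ((b - 2) - b / y\<^sup>2) / (2 * (b - 1))" for y
  have dg: "(slope_sign b has_real_derivative dg y) (at y)" if "0 < y" for y
    unfolding dg_def by (rule slope_sign_has_real_derivative[OF b that])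
  obtain z where z: "p < z" "z < q" "slope_sign b q - slope_sign b p = (q - p) * dg z"
    using MVT2[OF \<open>p < q\<close>, of "slope_sign b" dg] dg assms by auto
  have dg_pos: "0 < dg y \<longleftrightarrow> 0 < (b - 2) - b / y\<^sup>2" "0 \<le> dg y \<longleftrightarrow> 0 \<le> (b - 2) - b / y\<^sup>2" for y
    using b normal_density_pos[of 1 0 "(b - 2) / b * y"]
    by (auto simp: dg_def zero_less_mult_iff zero_le_mult_iff zero_less_divide_iff zero_le_divide_iff)
  have "0 \<le> (q - p) * dg z"
    using q z assms by linarith
  then have "0 \<le> (b - 2) - b / z\<^sup>2"
    using \<open>p < q\<close> dg_pos(2)[of z] by (simp add: zero_le_mult_iff)
  moreover have "b / y\<^sup>2 < b / z\<^sup>2" if "z < y" for y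
    using that z(1) b \<open>0 < p\<close> by (intro divide_strict_left_mono power_strict_mono) auto
  ultimately have pos: "0 < dg y" if "z < y" for y
    using that dg_pos(1)[of y] by fastforce
  have "0 < slope_sign b y" if "q < y" for y
  proof -
    have "slope_sign b q < slope_sign b y"
      by (rule DERIV_pos_imp_increasing[OF that]) (use dg pos z assms in \<open>meson less_le_trans less_trans\<close>)
    then show ?thesis using q by linarith
  qed
  with slope_sign_not_eventually_pos[OF b, of q] assms show False by force
qed

text \<open>Without a positive value, \<open>tail b y 1\<close> would decrease from its value 0 at
  \<open>y = 0\<close>, against positivity. Since a nonpositive value follows a positive one, there
  is a zero \<open>m\<close>, and \<open>slope_sign_neg_after\<close> leaves no other sign
  change.\<close>

lemma slope_sign_change:
  assumes b: "1 < b"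
  obtains m where "0 < m" "\<And>y. 0 < y \<Longrightarrow> y < m \<Longrightarrow> 0 < slope_sign b y"
    "\<And>y. m < y \<Longrightarrow> slope_sign b y < 0"
proof -
  have "\<exists>p>0. 0 < slope_sign b p"
  proof (rule ccontr)
    assume "\<not> ?thesis"
    then have np: "slope_sign b y \<le> 0" if "0 < y" for y
      using that by force
    have "tail b 1 1 < tail b 0 1"
    proof (rule tail_1_decreasing[OF b])
      fix y :: real assume y: "0 < y"
      \<comment> \<open>Starting from \<open>y / 2\<close> turns the weak inequality into a strict
        one.\<close>
      then show "slope_sign b y < 0"
        using slope_sign_neg_after[OF b, of "y / 2" y] np by simp
    qed auto
    then show False using tail_pos[of b 1 1] tail_1_0 b by simp
  qed
  then obtain p where p: "0 < p" "0 < slope_sign b p"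
    by blast
  obtain q where q: "p < q" "slope_sign b q \<le> 0"
    using slope_sign_not_eventually_pos[OF b, of p] p by auto
  have "continuous_on {p..q} (slope_sign b)"
    using p by (intro continuous_at_imp_continuous_on ballI DERIV_isCont[OF slope_sign_has_real_derivative[OF b]]) auto
  then obtain m where m: "p \<le> m" "m \<le> q" "slope_sign b m = 0"
    using IVT2'[of "slope_sign b" q 0 p] p q by auto
  show thesis
  proof (rule that[of m])
    show "0 < slope_sign b y" if "0 < y" "y < m" for y
      using slope_sign_neg_after[OF b, of y m] that m by force
  qed (use slope_sign_neg_after[OF b, of m] m p in auto)
qed

section \<open>Truncated integrals and their uniform convergence\<close>

text \<open>With \<open>k = c * M\<^sup>2 / D\<^sup>2\<close>, the upper limit \<open>c * t / u\<close> of the integral is \<open>k * t / y\<^sup>2\<close>.\<close>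

definition truncated :: "real \<Rightarrow> real \<Rightarrow> real \<Rightarrow> real \<Rightarrow> real" where
  "truncated b k t y = tail b y 1 - tail b y (1 + k * t / y\<^sup>2)"

text \<open>The argument of \<open>Phi\<close> in \<open>tail_le\<close> is, once positive,
  increasing in both \<open>y\<close> and \<open>s\<close>. A lower bound pairs the factor at
  \<open>y = l\<close> with the upper limit at \<open>y = r\<close>, hence \<open>w\<close> and
  \<open>v\<close>; it tends to infinity with \<open>t\<close>.\<close>

lemma tail_uniformly_small:
  assumes "1 < b" "0 < k" "0 < l" "0 < e"
  shows "\<forall>\<^sub>F t in at_top. \<forall>y\<in>{l..r}. tail b y (1 + k * t / y\<^sup>2) < e"
proof (cases "l \<le> r")
  case True
  define a where "a = b - 1"
  define w where "w = l / b"
  define v where "v = k / r\<^sup>2"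
  have pos: "0 < a" "0 < w" "0 < v" using assms True by (auto simp: a_def w_def v_def)
  have "filterlim (\<lambda>t. w * ((a * (1 + v * t) - 1) / sqrt (1 + v * t))) at_top at_top"
    using pos by real_asymp
  then have "((\<lambda>t. Phi (w * ((a * (1 + v * t) - 1) / sqrt (1 + v * t)))) \<longlongrightarrow> 1) at_top"
    by (rule filterlim_compose[OF Phi_at_top])
  then have "\<forall>\<^sub>F t in at_top. 1 - e < Phi (w * ((a * (1 + v * t) - 1) / sqrt (1 + v * t)))"
    using \<open>0 < e\<close> by (intro order_tendstoD) auto
  moreover have "\<forall>\<^sub>F t in at_top. 0 < a * (1 + v * t) - 1"
    using pos by real_asymp
  ultimately show ?thesis
    using eventually_gt_at_top[of 0]
  proof eventually_elim
    case (elim t)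
    show ?case
    proof
      fix y assume y: "y \<in> {l..r}"
      define s0 where "s0 = 1 + v * t"
      define s where "s = 1 + k * t / y\<^sup>2"
      have "1 < s0" using elim pos by (simp add: s0_def)
      have s: "s0 \<le> s"
        using y elim assms by (auto simp: s_def s0_def v_def intro!: divide_left_mono power_mono mult_pos_pos)
      \<comment> \<open>Both parts of the right-hand side increase with \<open>x\<close>.\<close>
      have eq: "(a * x - 1) / sqrt x = a * sqrt x - 1 / sqrt x" if "1 < x" for x
        using that by (simp add: diff_divide_distrib real_div_sqrt flip: times_divide_eq_right)
      have "(a * s0 - 1) / sqrt s0 \<le> (a * s - 1) / sqrt s"
        using s \<open>1 < s0\<close> pos
        by (simp add: eq) (intro diff_mono mult_left_mono divide_left_mono, auto)
      then have "w * ((a * s0 - 1) / sqrt s0) \<le> y / b * ((a * s - 1) / sqrt s)"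
        using y elim(2) assms pos \<open>1 < s0\<close>
        by (intro mult_mono) (auto simp: w_def s0_def divide_right_mono intro!: divide_nonneg_nonneg)
      then have "Phi (w * ((a * s0 - 1) / sqrt s0)) \<le> Phi (y / b * ((a * s - 1) / sqrt s))"
        by (rule Phi_mono)
      then show "tail b y (1 + k * t / y\<^sup>2) < e"
        using tail_le[OF \<open>1 < b\<close>, of y s] elim(1) by (simp add: s_def s0_def a_def)
    qed
  qed
qed auto

lemma unimodal_limit_truncated:
  assumes b: "1 < b" and k: "0 < k"
  obtains m where "unimodal_limit (\<lambda>y. tail b y 1) (truncated b k) m"
proof -
  obtain m where m: "0 < m" "\<And>y. 0 < y \<Longrightarrow> y < m \<Longrightarrow> 0 < slope_sign b y"
    "\<And>y. m < y \<Longrightarrow> slope_sign b y < 0"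
    using slope_sign_change[OF b] by blast
  have "unimodal_limit (\<lambda>y. tail b y 1) (truncated b k) m"
  proof
    fix t :: real assume "0 < t"
    then have pos: "0 < 1 + k * t / y\<^sup>2" if "0 < y" for y
      using k that by (intro add_pos_pos divide_pos_pos mult_pos_pos) auto
    have "continuous_on {0<..} (\<lambda>y. tail b y (1 + k * t / y\<^sup>2))"
      by (rule continuous_on_tail) (use pos b in \<open>auto intro!: continuous_intros\<close>)
    then show "continuous_on {0<..} (truncated b k t)"
      unfolding truncated_def using b by (intro continuous_on_diff continuous_on_tail_1) auto
    show "truncated b k t y < tail b y 1" if "0 < y" for y
      using tail_pos[OF b that pos[OF that]] by (simp add: truncated_def)
  next
    show "\<forall>\<^sub>F t in at_top. \<forall>y\<in>{l..r}. tail b y 1 - e < truncated b k t y" if "0 < l" "0 < e" for l e r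
      using tail_uniformly_small[OF b k that, of r] by (simp add: truncated_def)
    show "tail b x 1 < tail b y 1" if "0 \<le> x" "x < y" "y \<le> m" for x y
      by (rule tail_1_increasing) (use b m that in auto)
    show "tail b y 1 < tail b x 1" if "m \<le> x" "x < y" for x y
      by (rule tail_1_decreasing) (use b m that in auto)
  qed (use b m in \<open>auto intro!: continuous_on_tail_1 tail_1_at_top simp: tail_1_0\<close>)
  then show thesis by (rule that)
qed

section \<open>The original integral and equation in the variable \<open>y\<close>\<close>

lemma heuristic_prob_eq:
  assumes "0 < M" "0 < D" "0 < c" "0 < t" "0 < u"
  shows "heuristic_prob M D u c t = truncated (c * M) (c * M\<^sup>2 / D\<^sup>2) t (sqrt u * M / D)"
proof -
  define b where "b = c * M"
  define y where "y = sqrt u * M / D"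
  have "0 < b" "0 < y" using assms by (auto simp: b_def y_def)
  have yb: "y / b = sqrt u / (c * D)" using assms by (simp add: y_def b_def)
  have dens: "1 / (x + 1) * normal_density (c * M * (x + 1)) (sqrt (c\<^sup>2 * D\<^sup>2 / u * (x + 1))) x
     = y / b / ((1 + x) * sqrt (1 + x)) * std_normal_density (y / b * (((b - 1) * (1 + x) + 1) / sqrt (1 + x)))"
    if "0 \<le> x" for x
  proof -
    define s where "s = 1 + x"
    have s: "0 < s" "x + 1 = s" "x = s - 1" using that by (auto simp: s_def)
    have var: "(sqrt (c\<^sup>2 * D\<^sup>2 / u * s))\<^sup>2 = c\<^sup>2 * D\<^sup>2 / u * s"
      using assms s by simp
    have root: "sqrt (2 * pi * (c\<^sup>2 * D\<^sup>2 / u * s)) = sqrt (2 * pi) * (c * D / sqrt u * sqrt s)"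
      using assms by (simp add: real_sqrt_mult real_sqrt_divide)
    \<comment> \<open>Here \<open>s - 1 - b * s = - ((b - 1) * s + 1)\<close>.\<close>
    have exponent: "- (s - 1 - b * s)\<^sup>2 / (2 * (c\<^sup>2 * D\<^sup>2 / u * s))
        = - (y / b * (((b - 1) * s + 1) / sqrt s))\<^sup>2 / 2"
      unfolding yb using assms s(1)
      by (simp add: power_mult_distrib power_divide) (simp add: field_simps power2_eq_square)
    have "1 / s * normal_density (b * s) (sqrt (c\<^sup>2 * D\<^sup>2 / u * s)) (s - 1)
        = y / b / (s * sqrt s) * std_normal_density (y / b * (((b - 1) * s + 1) / sqrt s))"
      unfolding normal_density_def[of "b * s"] std_normal_density_def var root exponent
      unfolding yb using assms s(1) by simp
    then show ?thesis
      by (simp add: s_def b_def add.commute[of x 1])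
  qed
  \<comment> \<open>\<open>tail\<close> integrates from \<open>s = 1 + x\<close> upwards, so its
    negative is the antiderivative.\<close>
  define G where "G x = - tail b y (1 + x)" for x
  have "((\<lambda>x. 1 / (x + 1) * normal_density (c * M * (x + 1)) (sqrt (c\<^sup>2 * D\<^sup>2 / u * (x + 1))) x)
      has_integral G (c * t / u) - G 0) {0..c * t / u}"
  proof (rule fundamental_theorem_of_calculus)
    fix x assume x: "x \<in> {0..c * t / u}"
    have "((\<lambda>x. 1 + x) has_real_derivative 1) (at x)"
      by (auto intro!: derivative_eq_intros)
    from DERIV_chain2[OF tail_has_real_derivative this, of b y, THEN DERIV_minus] x \<open>0 < b\<close>
    have "(G has_real_derivative
        1 / (x + 1) * normal_density (c * M * (x + 1)) (sqrt (c\<^sup>2 * D\<^sup>2 / u * (x + 1))) x) (at x)"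
      unfolding G_def[abs_def] by (subst dens) auto
    then show "(G has_vector_derivative
        1 / (x + 1) * normal_density (c * M * (x + 1)) (sqrt (c\<^sup>2 * D\<^sup>2 / u * (x + 1))) x)
        (at x within {0..c * t / u})"
      by (simp add: has_real_derivative_iff_has_vector_derivative has_vector_derivative_at_within)
  qed (use assms in auto)
  then have "heuristic_prob M D u c t = G (c * t / u) - G 0"
    unfolding heuristic_prob_def by (rule integral_unique)
  moreover have "c * t / u = c * M\<^sup>2 / D\<^sup>2 * t / y\<^sup>2"
    using assms by (simp add: y_def power_divide power_mult_distrib)
  ultimately show ?thesis
    by (simp add: truncated_def G_def b_def y_def)
qed

lemma is_x_iff:
  assumes "c * M \<noteq> 0"
  shows "is_x M \<alpha> c x \<longleftrightarrow> 0 < x \<and> tail (c * M) (sqrt x) 1 = \<alpha>"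
proof -
  have "tail (c * M) (sqrt x) 1 = (1 - Phi ((c * M - 2) / (c * M) * sqrt x))
      * exp (- 2 * ((c * M - 1) / (c\<^sup>2 * M\<^sup>2)) * x) + Phi (sqrt x) - 1" if "0 < x"
    using tail_1[OF assms, of "sqrt x"] that by (simp add: power_mult_distrib)
  then show ?thesis
    unfolding is_x_def by auto
qed

subsection \<open>Asymptotics of the fixed-probability level\<close>

text \<open>As the level equation has several solutions, the asymptotics is split by how a level is
  selected. An arbitrary selection may jump between the two branches, so its \<open>x\<close>
  depends on \<open>t\<close>; a continuous one stays on one branch; each solution \<open>x\<close>
  is approached by some selection; the greatest levels belong to the greatest \<open>x\<close>. The
  threshold is the maximum of the limit function.\<close>

theorem theorem6p8:
  fixes M D K c :: real
  assumes "M > 0" and "D > 0" and "K > 1" and "c > K * cstar M"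
  shows "\<exists>\<alpha>0>0. \<forall>\<alpha>>0.
    ((\<forall>\<^sub>F t in at_top. \<exists>u. is_level M D \<alpha> c t u) \<longleftrightarrow> \<alpha> < \<alpha>0) \<and>
    (\<alpha> < \<alpha>0 \<longrightarrow>
      (\<forall>u. (\<forall>\<^sub>F t in at_top. is_level M D \<alpha> c t (u t)) \<longrightarrow>
         (\<exists>x. (\<forall>t. is_x M \<alpha> c (x t)) \<and> u \<sim>[at_top] (\<lambda>t. D\<^sup>2 / M\<^sup>2 * x t))) \<and>
      (\<forall>u t0. (\<forall>\<^sub>F t in at_top. is_level M D \<alpha> c t (u t)) \<and> continuous_on {t0..} u \<longrightarrow>
         (\<exists>x. is_x M \<alpha> c x \<and> u \<sim>[at_top] (\<lambda>t. D\<^sup>2 / M\<^sup>2 * x))) \<and>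
      (\<forall>x. is_x M \<alpha> c x \<longrightarrow>
         (\<exists>u. (\<forall>\<^sub>F t in at_top. is_level M D \<alpha> c t (u t)) \<and>
              u \<sim>[at_top] (\<lambda>t. D\<^sup>2 / M\<^sup>2 * x))) \<and>
      (\<exists>u x. (\<forall>\<^sub>F t in at_top. is_greatest (is_level M D \<alpha> c t) (u t)) \<and>
             is_greatest (is_x M \<alpha> c) x \<and>
             u \<sim>[at_top] (\<lambda>t. D\<^sup>2 / M\<^sup>2 * x)))"
proof -
  define b where "b = c * M"
  define k where "k = c * M\<^sup>2 / D\<^sup>2"
  have "K < c * M"
    using assms by (simp add: cstar_def field_simps)
  then have b: "1 < b" and c: "0 < c" and k: "0 < k"
    using assms zero_less_mult_pos2[of c M] by (auto simp: b_def k_def)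
  obtain m where "unimodal_limit (\<lambda>y. tail b y 1) (truncated b k) m"
    by (rule unimodal_limit_truncated[OF b k])
  then interpret unimodal_limit "\<lambda>y. tail b y 1" "truncated b k" m .
  \<comment> \<open>\<open>Y\<close> and \<open>U\<close> are mutually inverse on the positive
    reals, and \<open>U y\<close> is the claimed asymptotic value at
    \<open>x = y\<^sup>2\<close>.\<close>
  define Y where "Y u = sqrt u * M / D" for u
  define U where "U y = D\<^sup>2 / M\<^sup>2 * y\<^sup>2" for y
  have Y_U: "Y (U y) = y" "0 < U y" if "0 < y" for y
    using assms that by (auto simp: Y_def U_def real_sqrt_mult real_sqrt_divide)
  have U_Y: "U (Y u) = u" "0 < Y u" if "0 < u" for u
    using assms that by (auto simp: Y_def U_def power_mult_distrib power_divide)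
  have Y_le_iff: "Y u \<le> Y v \<longleftrightarrow> u \<le> v" for u v
    using assms by (simp add: Y_def divide_le_cancel)
  have level_iff: "is_level M D \<alpha> c t u \<longleftrightarrow> 0 < u \<and> truncated b k t (Y u) = \<alpha>" if "0 < t" for \<alpha> t u
    using heuristic_prob_eq[OF assms(1,2) c that, of u] by (auto simp: is_level_def b_def k_def Y_def)
  have x_iff: "is_x M \<alpha> c x \<longleftrightarrow> 0 < x \<and> tail b (sqrt x) 1 = \<alpha>" for \<alpha> x
    unfolding b_def by (rule is_x_iff) (use assms c in simp)
  show ?thesis
  proof (rule exI[of _ "tail b m 1"], intro conjI allI impI)
    show "0 < tail b m 1" by (rule max_pos)
    fix \<alpha> :: real assume \<alpha>: "0 < \<alpha>"
    show "(\<forall>\<^sub>F t in at_top. \<exists>u. is_level M D \<alpha> c t u) \<longleftrightarrow> \<alpha> < tail b m 1"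
    proof
      assume "\<forall>\<^sub>F t in at_top. \<exists>u. is_level M D \<alpha> c t u"
      then have "\<forall>\<^sub>F t in at_top. 0 < t \<and> (\<exists>u. is_level M D \<alpha> c t u)"
        using eventually_gt_at_top[of 0] by eventually_elim auto
      then obtain t u where "0 < t" "is_level M D \<alpha> c t u"
        by (auto dest: eventually_happens)
      then show "\<alpha> < tail b m 1"
        using no_root[of \<alpha> t "Y u"] U_Y[of u] by (force simp: level_iff)
    next
      assume "\<alpha> < tail b m 1"
      with \<alpha> interpret unimodal_limit_level "\<lambda>y. tail b y 1" "truncated b k" m \<alpha>
        by unfold_locales
      show "\<forall>\<^sub>F t in at_top. \<exists>u. is_level M D \<alpha> c t u"
        using ex_lower_root eventually_gt_at_top[of 0]
      proof eventually_elim
        case (elim t)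
        then obtain y where "0 < y" "truncated b k t y = \<alpha>" by blast
        then show ?case
          using elim(2) by (intro exI[of _ "U y"]) (simp add: level_iff Y_U)
      qed
    qed
    assume "\<alpha> < tail b m 1"
    with \<alpha> interpret unimodal_limit_level "\<lambda>y. tail b y 1" "truncated b k" m \<alpha>
      by unfold_locales
    have x_nearest: "is_x M \<alpha> c ((nearest y)\<^sup>2)" for y
      using nearest_ge[of y] h_nearest[of y] y1(1) by (auto simp: x_iff)
    have root: "\<forall>\<^sub>F t in at_top. 0 < Y (u t) \<and> truncated b k t (Y (u t)) = \<alpha>"
      if "\<forall>\<^sub>F t in at_top. is_level M D \<alpha> c t (u t)" for u
      using that eventually_gt_at_top[of 0] by eventually_elim (simp add: level_iff U_Y)
    have equiv: "u \<sim>[at_top] (\<lambda>t. D\<^sup>2 / M\<^sup>2 * (nearest (Y (u t)))\<^sup>2)"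
      if "\<forall>\<^sub>F t in at_top. is_level M D \<alpha> c t (u t)" for u
    proof -
      have U_equiv: "(\<lambda>t. U (Y (u t))) \<sim>[at_top] (\<lambda>t. D\<^sup>2 / M\<^sup>2 * (nearest (Y (u t)))\<^sup>2)"
        unfolding U_def by (intro asymp_equiv_intros root_asymp_equiv_nearest root that)
      have "\<forall>\<^sub>F t in at_top. u t = U (Y (u t))"
        using that by eventually_elim (simp add: is_level_def U_Y)
      from asymp_equiv_trans[OF asymp_equiv_refl_ev[OF this] U_equiv] show ?thesis .
    qed
    have equiv_const: "u \<sim>[at_top] (\<lambda>t. D\<^sup>2 / M\<^sup>2 * n\<^sup>2)"
      if "\<forall>\<^sub>F t in at_top. is_level M D \<alpha> c t (u t)" "\<forall>\<^sub>F t in at_top. nearest (Y (u t)) = n" for u n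
    proof -
      have "\<forall>\<^sub>F t in at_top. D\<^sup>2 / M\<^sup>2 * (nearest (Y (u t)))\<^sup>2 = D\<^sup>2 / M\<^sup>2 * n\<^sup>2"
        using that(2) by eventually_elim simp
      from asymp_equiv_trans[OF equiv[OF that(1)] asymp_equiv_refl_ev[OF this]] show ?thesis .
    qed
    \<comment> \<open>Roots left of \<open>m\<close> realise the smaller solution; the greatest
      roots \<open>g t\<close> realise the larger one.\<close>
    obtain l where l: "\<forall>\<^sub>F t in at_top. 0 < l t \<and> l t < m \<and> truncated b k t (l t) = \<alpha>"
      using ex_lower_root unfolding eventually_ex by blast
    have l_level: "\<forall>\<^sub>F t in at_top. is_level M D \<alpha> c t (U (l t))"
      using l eventually_gt_at_top[of 0] by eventually_elim (simp add: level_iff Y_U)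
    have l_equiv: "(\<lambda>t. U (l t)) \<sim>[at_top] (\<lambda>t. D\<^sup>2 / M\<^sup>2 * y1\<^sup>2)"
      by (rule equiv_const[OF l_level], rule eventually_mono[OF l]) (simp add: Y_U nearest_def)
    obtain g where g: "\<forall>\<^sub>F t in at_top. m < g t \<and> truncated b k t (g t) = \<alpha> \<and>
        (\<forall>z>0. truncated b k t z = \<alpha> \<longrightarrow> z \<le> g t)"
      using ex_greatest_root unfolding eventually_ex by blast
    have g_greatest: "\<forall>\<^sub>F t in at_top. is_greatest (is_level M D \<alpha> c t) (U (g t))"
      using g eventually_gt_at_top[of 0]
    proof eventually_elim
      case (elim t)
      then have "0 < g t" using m_pos by linarith
      have "v \<le> U (g t)" if "is_level M D \<alpha> c t v" for v
      proof -
        have "Y v \<le> Y (U (g t))"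
          using that elim U_Y(2)[of v] \<open>0 < g t\<close> by (simp add: level_iff Y_U)
        then show ?thesis by (simp add: Y_le_iff)
      qed
      then show ?case
        using elim \<open>0 < g t\<close> by (simp add: is_greatest_def level_iff Y_U)
    qed
    then have g_level: "\<forall>\<^sub>F t in at_top. is_level M D \<alpha> c t (U (g t))"
      by eventually_elim (simp add: is_greatest_def)
    have g_equiv: "(\<lambda>t. U (g t)) \<sim>[at_top] (\<lambda>t. D\<^sup>2 / M\<^sup>2 * y2\<^sup>2)"
      by (rule equiv_const[OF g_level], rule eventually_mono[OF g]) (use m_pos in \<open>simp add: Y_U nearest_def\<close>)
    show "\<exists>x. (\<forall>t. is_x M \<alpha> c (x t)) \<and> u \<sim>[at_top] (\<lambda>t. D\<^sup>2 / M\<^sup>2 * x t)"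
      if "\<forall>\<^sub>F t in at_top. is_level M D \<alpha> c t (u t)" for u
      using equiv[OF that] x_nearest by (intro exI[of _ "\<lambda>t. (nearest (Y (u t)))\<^sup>2"]) auto
    show "\<exists>x. is_x M \<alpha> c x \<and> u \<sim>[at_top] (\<lambda>t. D\<^sup>2 / M\<^sup>2 * x)"
      if "(\<forall>\<^sub>F t in at_top. is_level M D \<alpha> c t (u t)) \<and> continuous_on {t0..} u" for u t0
    proof -
      note level = conjunct1[OF that]
      have cont: "continuous_on {t0..} (\<lambda>t. Y (u t))"
        unfolding Y_def using that assms by (auto intro!: continuous_intros)
      obtain T where "\<forall>\<^sub>F t in at_top. nearest (Y (u t)) = nearest (Y (u T))"
        by (rule continuous_root_nearest_constant[OF root[OF level] cont])
      from equiv_const[OF level this] x_nearest show ?thesis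
        by blast
    qed
    show "\<exists>u. (\<forall>\<^sub>F t in at_top. is_level M D \<alpha> c t (u t)) \<and> u \<sim>[at_top] (\<lambda>t. D\<^sup>2 / M\<^sup>2 * x)"
      if "is_x M \<alpha> c x" for x
    proof -
      have "0 < x" "sqrt x = y1 \<or> sqrt x = y2"
        using that h_eq_iff[of "sqrt x"] by (auto simp: x_iff)
      then have "x = y1\<^sup>2 \<or> x = y2\<^sup>2"
        by (metis less_imp_le real_sqrt_pow2)
      then show ?thesis
      proof
        assume "x = y1\<^sup>2"
        with l_level l_equiv show ?thesis by (intro exI[of _ "\<lambda>t. U (l t)"]) simp
      next
        assume "x = y2\<^sup>2"
        with g_level g_equiv show ?thesis by (intro exI[of _ "\<lambda>t. U (g t)"]) simp
      qed
    qed
    have "is_greatest (is_x M \<alpha> c) (y2\<^sup>2)"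
      unfolding is_greatest_def
    proof (intro conjI allI impI)
      show "is_x M \<alpha> c (y2\<^sup>2)"
        using y1 y2 by (simp add: x_iff)
      fix x assume "is_x M \<alpha> c x"
      then have "0 < x" "sqrt x \<le> y2"
        using h_eq_iff[of "sqrt x"] y1 y2 by (auto simp: x_iff)
      then show "x \<le> y2\<^sup>2"
        by (simp add: sqrt_le_D)
    qed
    then show "\<exists>u x. (\<forall>\<^sub>F t in at_top. is_greatest (is_level M D \<alpha> c t) (u t)) \<and>
             is_greatest (is_x M \<alpha> c) x \<and>
             u \<sim>[at_top] (\<lambda>t. D\<^sup>2 / M\<^sup>2 * x)"
      using g_greatest g_equiv by (intro exI[of _ "\<lambda>t. U (g t)"] exI[of _ "y2\<^sup>2"]) simp
  qed
qed

end
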